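(* Let $N\ge2$, $p_A\in(0,1)$, $\sigma_0,\sigma_1>0$. (1) If $\sigma_0>\sigma_1$ and $$\log\!\left(\frac{\sigma_1^2}{\sigma_0^2}\right)+1-\frac{\sigma_1^2}{\sigma_0^2}<\frac{2\log(1-p_A)}{N},$$ then $\xi_>(a,\sigma_1)>\tfrac12$ for every $a\ge0$. (2) If $\sigma_0<\sigma_1$ and $$\log\!\left(\frac{\sigma_1^2}{\sigma_0^2}\frac{N-1}{N}\right)+1-\frac{\sigma_1^2}{\sigma_0^2}\frac{N-1}{N}<\frac{2\log(1-p_A)}{N},$$ then $\xi_<(a,\sigma_1)>\tfrac12$ for every $a\ge0$. (Here $\xi(a,\sigma_1)>1/2$ means that a point $x_1$ with $\|x_1-x_0\|=a$ smoothed with standard deviation $\sigma_1$ cannot be certified from $x_0$ smoothed with $\sigma_0$ and top-class probability $p_A$.)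
   Context: $\chi^2_N(\lambda,x)=\mathbb{P}(\|Z+\mu\|^2\le x)$ for $Z\sim\mathcal{N}(0,I_N)$, $\|\mu\|^2=\lambda\ge 0$ (noncentral chi-squared cdf), and $\chi^2_{N,qf}(\lambda,p)=\inf\{x:\chi^2_N(\lambda,x)\ge p\}$ for $p\in(0,1)$ its quantile function. Fix $N$, $\sigma_0>0$, $p_A\in(0,1)$. For $a\ge0$ and $0<\sigma_1<\sigma_0$ define $$\xi_>(a,\sigma_1)=\chi^2_N\!\left(\frac{\sigma_1^2a^2}{(\sigma_0^2-\sigma_1^2)^2},\ \frac{\sigma_0^2}{\sigma_1^2}\chi^2_{N,qf}\!\left(\frac{\sigma_0^2a^2}{(\sigma_0^2-\sigma_1^2)^2},1-p_A\right)\right),$$ and for $\sigma_1>\sigma_0$ define $$\xi_<(a,\sigma_1)=1-\chi^2_N\!\left(\frac{\sigma_1^2a^2}{(\sigma_1^2-\sigma_0^2)^2},\ \frac{\sigma_0^2}{\sigma_1^2}\chi^2_{N,qf}\!\left(\frac{\sigma_0^2a^2}{(\sigma_1^2-\sigma_0^2)^2},p_A\right)\right).$$ These equal the maximal probability $\mathbb{P}(f(Y_1)=B)$, $Y_1\sim\mathcal N(x_1,\sigma_1^2 I_N)$, over binary classifiers $f$ with $\mathbb{P}(f(Y_0)=B)\le 1-p_A$, $Y_0\sim\mathcal N(x_0,\sigma_0^2I_N)$, where $a=\|x_1-x_0\|$. *)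

theory Defs
  imports "HOL-Probability.Probability"
begin

definition std_gauss :: "nat \<Rightarrow> (nat \<Rightarrow> real) measure" where
  "std_gauss N = PiM {..<N} (\<lambda>_. density lborel (\<lambda>x. ennreal (std_normal_density x)))"

text \<open>Noncentral chi-squared cdf: P(||Z + mu||^2 <= x), Z ~ N(0, I_N), ||mu||^2 = lam.
  By rotation invariance we may take mu = (sqrt lam, 0, ..., 0).\<close>
definition nc_chi2 :: "nat \<Rightarrow> real \<Rightarrow> real \<Rightarrow> real" where
  "nc_chi2 N lam x = measure (std_gauss N)
     {z \<in> space (std_gauss N).
        (\<Sum>i<N. (z i + (if i = 0 then sqrt lam else 0))\<^sup>2) \<le> x}"

definition nc_chi2_qf :: "nat \<Rightarrow> real \<Rightarrow> real \<Rightarrow> real" where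
  "nc_chi2_qf N lam p = Inf {x. nc_chi2 N lam x \<ge> p}"

definition xi_gt :: "nat \<Rightarrow> real \<Rightarrow> real \<Rightarrow> real \<Rightarrow> real \<Rightarrow> real" where
  "xi_gt N sigma0 pA a sigma1 =
     nc_chi2 N (sigma1\<^sup>2 * a\<^sup>2 / (sigma0\<^sup>2 - sigma1\<^sup>2)\<^sup>2)
       (sigma0\<^sup>2 / sigma1\<^sup>2 * nc_chi2_qf N (sigma0\<^sup>2 * a\<^sup>2 / (sigma0\<^sup>2 - sigma1\<^sup>2)\<^sup>2) (1 - pA))"

definition xi_lt :: "nat \<Rightarrow> real \<Rightarrow> real \<Rightarrow> real \<Rightarrow> real \<Rightarrow> real" where
  "xi_lt N sigma0 pA a sigma1 =
     1 - nc_chi2 N (sigma1\<^sup>2 * a\<^sup>2 / (sigma1\<^sup>2 - sigma0\<^sup>2)\<^sup>2)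
       (sigma0\<^sup>2 / sigma1\<^sup>2 * nc_chi2_qf N (sigma0\<^sup>2 * a\<^sup>2 / (sigma1\<^sup>2 - sigma0\<^sup>2)\<^sup>2) pA)"

end

theory Submission
  imports Defs
begin

text \<open>
  In coordinates centred at the centre of the likelihood-ratio ball, both Gaussians have a mean
  proportional to their variance, \<open>N(\<sigma>\<^sup>2 b e\<^sub>0, \<sigma>\<^sup>2 I)\<close>, so the linear terms of the log-density ratio cancel
  and the ratio is a monotone function of the norm. By the Neyman-Pearson lemma \<open>\<xi>(a)\<close> is therefore
  at least the probability under \<open>Y\<^sub>1\<close> of any region whose probability under \<open>Y\<^sub>0\<close> is at most \<open>1 - p\<^sub>A\<close>.

  If \<open>\<sigma>\<^sub>1 < \<sigma>\<^sub>0\<close>, take the ball of squared radius \<open>N \<sigma>\<^sub>1\<^sup>2\<close> around \<open>x\<^sub>1\<close>: the median of \<open>\<chi>\<^sup>2\<^sub>N\<close> is below \<open>N\<close>, and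
  a Chernoff bound controls the probability under \<open>Y\<^sub>0\<close>. If \<open>\<sigma>\<^sub>0 < \<sigma>\<^sub>1\<close>, take the complement of the ball
  of squared radius \<open>(N - 1) \<sigma>\<^sub>1\<^sup>2\<close> around \<open>x\<^sub>0\<close>: the median of \<open>\<chi>\<^sup>2\<^sub>N\<close> exceeds \<open>N - 1\<close>, and moving the ball
  off centre only decreases its Gaussian measure.
\<close>

section \<open>Product measures and the Neyman-Pearson lemma\<close>

text \<open>The preimage of a box under a coordinatewise map is the box of preimages, so both
  measures agree on boxes, which determine a finite product measure.\<close>

lemma PiM_distr_eq:
  assumes I: "finite I" and M': "product_sigma_finite M'"
    and M: "product_sigma_finite M"
    and f [measurable]: "\<And>i. i \<in> I \<Longrightarrow> f i \<in> measurable (M i) (M' i)"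
    and eq: "\<And>i. i \<in> I \<Longrightarrow> distr (M i) (M' i) (f i) = M' i"
  shows "distr (PiM I M) (PiM I M') (\<lambda>x. \<lambda>i\<in>I. f i (x i)) = PiM I M'"
proof (rule product_sigma_finite.PiM_eqI[OF M' I])
  interpret product_sigma_finite M by (rule M)
  have [measurable]: "(\<lambda>x. \<lambda>i\<in>I. f i (x i)) \<in> measurable (PiM I M) (PiM I M')"
    by measurable
  fix A assume A: "\<And>i. i \<in> I \<Longrightarrow> A i \<in> sets (M' i)"
  have "(\<lambda>x. \<lambda>i\<in>I. f i (x i)) -` Pi\<^sub>E I A \<inter> space (PiM I M) = Pi\<^sub>E I (\<lambda>i. f i -` A i \<inter> space (M i))"
    by (auto simp: space_PiM PiE_def Pi_def extensional_def)
  moreover have "Pi\<^sub>E I A \<in> sets (PiM I M')"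
    using I A by (intro sets_PiM_I_finite) auto
  ultimately have "emeasure (distr (PiM I M) (PiM I M') (\<lambda>x. \<lambda>i\<in>I. f i (x i))) (Pi\<^sub>E I A)
      = emeasure (PiM I M) (Pi\<^sub>E I (\<lambda>i. f i -` A i \<inter> space (M i)))"
    by (simp add: emeasure_distr)
  also have "\<dots> = (\<Prod>i\<in>I. emeasure (M i) (f i -` A i \<inter> space (M i)))"
    using A by (intro emeasure_PiM I measurable_sets[OF f]) auto
  also have "\<dots> = (\<Prod>i\<in>I. emeasure (M' i) (A i))"
  proof (rule prod.cong)
    fix i assume i: "i \<in> I"
    have "emeasure (M' i) (A i) = emeasure (distr (M i) (M' i) (f i)) (A i)"
      by (simp add: eq i)
    then show "emeasure (M i) (f i -` A i \<inter> space (M i)) = emeasure (M' i) (A i)"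
      using i by (simp add: emeasure_distr A f)
  qed simp
  finally show "emeasure (distr (PiM I M) (PiM I M') (\<lambda>x. \<lambda>i\<in>I. f i (x i))) (Pi\<^sub>E I A)
      = (\<Prod>i\<in>I. emeasure (M' i) (A i))" .
qed simp

text \<open>On a box the integrand is a product of one-variable factors, so the integral splits into
  the one-dimensional masses.\<close>

lemma PiM_density_eq:
  assumes I: "finite I" and M: "product_sigma_finite M" and M': "product_sigma_finite M'"
    and h [measurable]: "\<And>i. i \<in> I \<Longrightarrow> h i \<in> borel_measurable (M i)"
    and eq: "\<And>i. i \<in> I \<Longrightarrow> M' i = density (M i) (h i)"
  shows "PiM I M' = density (PiM I M) (\<lambda>x. \<Prod>i\<in>I. h i (x i))"
proof (rule product_sigma_finite.PiM_eqI[OF M' I, symmetric])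
  interpret product_sigma_finite M by (rule M)
  show "sets (density (PiM I M) (\<lambda>x. \<Prod>i\<in>I. h i (x i))) = sets (PiM I M')"
    by (auto intro!: sets_PiM_cong simp: eq)
  fix A assume "\<And>i. i \<in> I \<Longrightarrow> A i \<in> sets (M' i)"
  then have A: "\<And>i. i \<in> I \<Longrightarrow> A i \<in> sets (M i)" by (simp add: eq)
  have "Pi\<^sub>E I A \<in> sets (PiM I M)"
    using I A by (intro sets_PiM_I_finite) auto
  then have "emeasure (density (PiM I M) (\<lambda>x. \<Prod>i\<in>I. h i (x i))) (Pi\<^sub>E I A)
      = (\<integral>\<^sup>+x. (\<Prod>i\<in>I. h i (x i)) * indicator (Pi\<^sub>E I A) x \<partial>PiM I M)"
    using I by (intro emeasure_density) auto
  also have "\<dots> = (\<integral>\<^sup>+x. (\<Prod>i\<in>I. h i (x i) * indicator (A i) (x i)) \<partial>PiM I M)"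
  proof (rule nn_integral_cong)
    fix x assume "x \<in> space (PiM I M)"
    then have "indicator (Pi\<^sub>E I A) x = (\<Prod>i\<in>I. indicator (A i) (x i) :: ennreal)"
      using I by (auto simp: indicator_def space_PiM PiE_def Pi_def)
    then show "(\<Prod>i\<in>I. h i (x i)) * indicator (Pi\<^sub>E I A) x = (\<Prod>i\<in>I. h i (x i) * indicator (A i) (x i))"
      by (simp add: prod.distrib)
  qed
  also have "\<dots> = (\<Prod>i\<in>I. \<integral>\<^sup>+x. h i x * indicator (A i) x \<partial>M i)"
    using A by (intro product_nn_integral_prod I) auto
  also have "\<dots> = (\<Prod>i\<in>I. emeasure (M' i) (A i))"
    by (intro prod.cong refl) (simp add: eq emeasure_density A)
  finally show "emeasure (density (PiM I M) (\<lambda>x. \<Prod>i\<in>I. h i (x i))) (Pi\<^sub>E I A)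
      = (\<Prod>i\<in>I. emeasure (M' i) (A i))" .
qed

text \<open>Remove the common part of \<open>A\<close> and \<open>R\<close>. What is left of
  \<open>R\<close> has density at most \<open>k\<close>, what is left of \<open>A\<close> at least
  \<open>k\<close>, and \<open>M\<close> gives the former no more mass. \<open>M\<close> may be
  infinite, so Lebesgue measure can be the null measure too.\<close>

lemma neyman_pearson:
  fixes h :: "'a \<Rightarrow> ennreal"
  assumes [measurable]: "A \<in> sets M" "R \<in> sets M" "h \<in> borel_measurable M"
    and ge: "\<And>x. x \<in> A \<Longrightarrow> k \<le> h x"
    and le: "\<And>x. x \<in> space M \<Longrightarrow> x \<notin> A \<Longrightarrow> h x \<le> k"
    and RA: "emeasure M R \<le> emeasure M A" and fin: "emeasure M R \<noteq> \<infinity>"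
  shows "emeasure (density M h) R \<le> emeasure (density M h) A"
proof -
  have split: "emeasure N X = emeasure N (A \<inter> R) + emeasure N (X - (A \<inter> R))"
    if "sets N = sets M" "X = A \<or> X = R" for X and N :: "'a measure"
  proof -
    have "(A \<inter> R) \<union> (X - (A \<inter> R)) = X" using that by auto
    then show ?thesis
      using that plus_emeasure[of "A \<inter> R" N "X - (A \<inter> R)"] by auto
  qed
  \<comment> \<open>Cancelling the common part in \<open>ennreal\<close> requires its mass to be
    finite.\<close>
  have fin': "emeasure M (A \<inter> R) \<noteq> \<infinity>"
    using fin emeasure_mono[of "A \<inter> R" R M] by (auto simp: top_unique)
  have *: "emeasure M (R - (A \<inter> R)) \<le> emeasure M (A - (A \<inter> R))"
    using RA split[of M R] split[of M A] fin' by (simp add: ennreal_add_left_cancel_le)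
  have "emeasure (density M h) (R - (A \<inter> R)) = (\<integral>\<^sup>+x. h x * indicator (R - A \<inter> R) x \<partial>M)"
    by (intro emeasure_density) auto
  also have "\<dots> \<le> (\<integral>\<^sup>+x. k * indicator (R - A \<inter> R) x \<partial>M)"
    by (intro nn_integral_mono) (auto simp: indicator_def le)
  also have "\<dots> = k * emeasure M (R - (A \<inter> R))"
    by (intro nn_integral_cmult_indicator) auto
  also have "\<dots> \<le> k * emeasure M (A - (A \<inter> R))"
    by (intro mult_left_mono *) auto
  also have "\<dots> = (\<integral>\<^sup>+x. k * indicator (A - A \<inter> R) x \<partial>M)"
    by (intro nn_integral_cmult_indicator[symmetric]) auto
  also have "\<dots> \<le> (\<integral>\<^sup>+x. h x * indicator (A - A \<inter> R) x \<partial>M)"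
    by (intro nn_integral_mono) (auto simp: indicator_def ge)
  also have "\<dots> = emeasure (density M h) (A - (A \<inter> R))"
    by (intro emeasure_density[symmetric]) auto
  finally show ?thesis
    using split[of "density M h" R] split[of "density M h" A] by (simp add: add_left_mono)
qed

section \<open>Shifted Gaussians\<close>

text \<open>The centre lies on the first axis because the noncentral mean does; all means and
  centres in the argument are collinear.\<close>

definition sqdist :: "nat \<Rightarrow> real \<Rightarrow> (nat \<Rightarrow> real) \<Rightarrow> real" where
  "sqdist N c y = (\<Sum>i<N. (y i - (if i = 0 then c else 0))\<^sup>2)"

abbreviation Leb :: "nat \<Rightarrow> (nat \<Rightarrow> real) measure" where
  "Leb N \<equiv> PiM {..<N} (\<lambda>_. lborel)"

text \<open>The mean is scaled by the variance so that in \<open>gauss_tilt\<close> below two of these measures with the same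
  \<open>b\<close> have a rotation-invariant density ratio.\<close>
definition gauss :: "nat \<Rightarrow> real \<Rightarrow> real \<Rightarrow> (nat \<Rightarrow> real) measure" where
  "gauss N b s = PiM {..<N} (\<lambda>i. density lborel (\<lambda>x. ennreal (normal_density (if i = 0 then s\<^sup>2 * b else 0) s x)))"

lemma sets_gauss: "sets (gauss N b s) = sets (Leb N)"
  unfolding gauss_def by (intro sets_PiM_cong) auto

lemma space_gauss: "space (gauss N b s) = space (Leb N)"
  by (intro sets_eq_imp_space_eq sets_gauss)

lemma measurable_sqdist [measurable]: "sqdist N c \<in> borel_measurable (Leb N)"
  unfolding sqdist_def by measurable

lemma std_gauss_eq: "std_gauss N = gauss N 0 1"
  unfolding std_gauss_def gauss_def by (intro arg_cong[where f = "PiM {..<N}"] ext) simp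

lemma sigma_finite_normal:
  "product_sigma_finite (\<lambda>i. density lborel (\<lambda>x. ennreal (normal_density (m i) (s i) x)))"
  if "\<And>i. s i > 0"
  unfolding product_sigma_finite_def
  using that by (auto intro!: prob_space_imp_sigma_finite prob_space_normal_density)

lemma sigma_finite_lborel: "product_sigma_finite (\<lambda>_. lborel)"
  unfolding product_sigma_finite_def by (auto intro: lborel.sigma_finite_measure_axioms)

lemma prob_space_gauss: "s > 0 \<Longrightarrow> prob_space (gauss N b s)"
  unfolding gauss_def by (intro prob_space_PiM prob_space_normal_density)

lemma gauss_affine:
  assumes s: "s > 0"
  shows "distr (gauss N 0 1) (gauss N b s)
           (\<lambda>x. \<lambda>i\<in>{..<N}. s * x i + (if i = 0 then s\<^sup>2 * b else 0)) = gauss N b s"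
  unfolding gauss_def
proof (rule PiM_distr_eq)
  fix i
  let ?m = "if i = 0 then s\<^sup>2 * b else 0"
  \<comment> \<open>This is a factor of \<open>gauss N 0 1\<close> exactly as unfolding leaves it, a
    standard normal law for every \<open>i\<close>.\<close>
  let ?N = "density lborel (\<lambda>x. ennreal (normal_density (if i = 0 then 1\<^sup>2 * 0 else 0) 1 x))"
  interpret N: prob_space ?N by (rule prob_space_normal_density) simp
  have "distributed ?N lborel (\<lambda>x. x) (normal_density 0 1)"
    by (auto simp: distributed_def distr_id2 intro!: distr_id2)
  from N.normal_density_affine[OF this, of s ?m] s
  have "distributed ?N lborel (\<lambda>x. ?m + s * x) (normal_density ?m s)" by simp
  then have "distr ?N lborel (\<lambda>x. s * x + ?m) = density lborel (\<lambda>x. ennreal (normal_density ?m s x))"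
    by (auto simp: distributed_def add.commute)
  also have "distr ?N lborel (\<lambda>x. s * x + ?m) = distr ?N (density lborel (\<lambda>x. ennreal (normal_density ?m s x))) (\<lambda>x. s * x + ?m)"
    by (intro distr_cong) auto
  finally show "\<dots> = density lborel (\<lambda>x. ennreal (normal_density ?m s x))" .
qed (use s in \<open>auto intro!: sigma_finite_normal\<close>)

text \<open>Substituting \<open>y = s z + s^2 b e_0\<close> gives
  \<open>y - c e_0 = s (z + (s b - c / s) e_0)\<close>. The condition on \<open>c\<close> makes this
  shift nonnegative, hence equal to the square root of its square that \<open>nc_chi2\<close> uses.
  With \<open>c = 0\<close> the noncentrality is \<open>(s b)^2\<close>, the form occurring in
  \<open>xi_gt\<close> and \<open>xi_lt\<close>.\<close>

lemma nc_chi2_eq_gauss: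
  assumes s: "s > 0" and c: "c \<le> s\<^sup>2 * b"
  shows "nc_chi2 N ((s * b - c / s)\<^sup>2) x
       = measure (gauss N b s) {y \<in> space (Leb N). sqdist N c y \<le> s\<^sup>2 * x}"
proof -
  let ?T = "\<lambda>x. \<lambda>i\<in>{..<N}. s * x i + (if i = 0 then s\<^sup>2 * b else 0)"
  have [measurable]: "?T \<in> measurable (gauss N 0 1) (gauss N b s)"
    unfolding gauss_def by measurable
  have [measurable]: "{y \<in> space (Leb N). sqdist N c y \<le> s\<^sup>2 * x} \<in> sets (gauss N b s)"
    unfolding sets_gauss by measurable
  have nn: "s * b - c / s \<ge> 0"
    using s c by (simp add: field_simps power2_eq_square)
  have sq: "sqdist N c (?T z) = s\<^sup>2 * (\<Sum>i<N. (z i + (if i = 0 then s * b - c / s else 0))\<^sup>2)" for z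
    unfolding sqdist_def sum_distrib_left
    using s by (intro sum.cong) (auto simp: field_simps power2_eq_square)
  have sqdist_iff: "sqdist N c (?T z) \<le> s\<^sup>2 * x \<longleftrightarrow>
     (\<Sum>i<N. (z i + (if i = 0 then s * b - c / s else 0))\<^sup>2) \<le> x" for z
    using s unfolding sq by (auto simp: mult_le_cancel_left_pos)
  have "measure (gauss N b s) {y \<in> space (Leb N). sqdist N c y \<le> s\<^sup>2 * x} =
        measure (gauss N 0 1) (?T -` {y \<in> space (Leb N). sqdist N c y \<le> s\<^sup>2 * x} \<inter> space (gauss N 0 1))"
    by (subst gauss_affine[OF s, symmetric]) (intro measure_distr; measurable)
  also have "?T -` {y \<in> space (Leb N). sqdist N c y \<le> s\<^sup>2 * x} \<inter> space (gauss N 0 1)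
    = {z \<in> space (std_gauss N). (\<Sum>i<N. (z i + (if i = 0 then s * b - c / s else 0))\<^sup>2) \<le> x}"
    unfolding std_gauss_eq using sqdist_iff by (auto simp: space_gauss space_PiM)
  also have "measure (gauss N 0 1) \<dots> = nc_chi2 N ((s * b - c / s)\<^sup>2) x"
    using nn unfolding nc_chi2_def std_gauss_eq by (simp only: real_sqrt_abs abs_of_nonneg)
  finally show ?thesis ..
qed

text \<open>Expanding \<open>(x - s^2 b)^2 / (2 s^2)\<close> yields the cross term
  \<open>b x\<close>, which is independent of \<open>s\<close> and cancels in the ratio; a constant
  and a multiple of \<open>x^2\<close> remain.\<close>

lemma gauss_tilt:
  assumes s: "s > 0" and t: "t > 0"
  shows "gauss N b s = density (gauss N b t)
    (\<lambda>y. ennreal ((t / s) ^ N * exp ((if N = 0 then 0 else (t\<^sup>2 - s\<^sup>2) * b\<^sup>2 / 2) + (1 / t\<^sup>2 - 1 / s\<^sup>2) * sqdist N 0 y / 2)))"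
proof -
  \<comment> \<open>Only coordinate 0 has a nonzero mean, so it alone contributes a constant; for
    \<open>N = 0\<close> that coordinate is absent, hence the case distinction in the
    statement.\<close>
  define d where "d i = (if i = (0::nat) then (t\<^sup>2 - s\<^sup>2) * b\<^sup>2 / 2 else 0)" for i
  define h where "h i x = (t / s) * exp (d i + (1 / t\<^sup>2 - 1 / s\<^sup>2) * x\<^sup>2 / 2)" for i and x :: real
  have hpos: "h i x \<ge> 0" for i x using s t by (simp add: h_def)
  have [measurable]: "h i \<in> borel_measurable borel" for i unfolding h_def by measurable
  have eq: "normal_density (if i = 0 then s\<^sup>2 * b else 0) s x =
            normal_density (if i = 0 then t\<^sup>2 * b else 0) t x * h i x" for i x
  proof -
    have "1 / sqrt (2 * pi * s\<^sup>2) = 1 / sqrt (2 * pi * t\<^sup>2) * (t / s)"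
      using s t by (simp add: real_sqrt_mult)
    moreover have "-(x - (if i = 0 then s\<^sup>2 * b else 0))\<^sup>2/ (2 * s\<^sup>2) =
       -(x - (if i = 0 then t\<^sup>2 * b else 0))\<^sup>2/ (2 * t\<^sup>2) + (d i + (1 / t\<^sup>2 - 1 / s\<^sup>2) * x\<^sup>2 / 2)"
      using s t unfolding d_def by (simp add: field_simps power2_eq_square)
    ultimately show ?thesis
      unfolding normal_density_def h_def by (simp only: exp_add mult_ac)
  qed
  have "gauss N b s = density (gauss N b t) (\<lambda>y. \<Prod>i<N. ennreal (h i (y i)))"
    unfolding gauss_def
  proof (rule PiM_density_eq)
    fix i
    show "density lborel (\<lambda>x. ennreal (normal_density (if i = 0 then s\<^sup>2 * b else 0) s x))
      = density (density lborel (\<lambda>x. ennreal (normal_density (if i = 0 then t\<^sup>2 * b else 0) t x))) (\<lambda>x. ennreal (h i x))"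
      by (subst density_density_eq) (simp_all add: eq hpos ennreal_mult)
  qed (use s t in \<open>auto intro!: sigma_finite_normal\<close>)
  moreover have "(\<Prod>i<N. ennreal (h i (y i))) =
     ennreal ((t / s) ^ N * exp ((if N = 0 then 0 else (t\<^sup>2 - s\<^sup>2) * b\<^sup>2 / 2) + (1 / t\<^sup>2 - 1 / s\<^sup>2) * sqdist N 0 y / 2))" for y
  proof -
    have "(\<Prod>i<N. h i (y i)) = (t / s) ^ N * exp (\<Sum>i<N. d i + (1 / t\<^sup>2 - 1 / s\<^sup>2) * (y i)\<^sup>2 / 2)"
      unfolding h_def prod.distrib exp_sum[OF finite_lessThan] by simp
    also have "(\<Sum>i<N. d i + (1 / t\<^sup>2 - 1 / s\<^sup>2) * (y i)\<^sup>2 / 2)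
       = (\<Sum>i<N. d i) + (1 / t\<^sup>2 - 1 / s\<^sup>2) * sqdist N 0 y / 2"
      unfolding sqdist_def by (simp add: sum.distrib sum_distrib_left sum_divide_distrib)
    also have "(\<Sum>i<N. d i) = (if N = 0 then 0 else (t\<^sup>2 - s\<^sup>2) * b\<^sup>2 / 2)"
      unfolding d_def by (subst sum.delta) auto
    finally show ?thesis using hpos by (simp add: prod_ennreal)
  qed
  ultimately show ?thesis by simp
qed

section \<open>Radial distributions\<close>

lemma Leb_translate:
  "distr (Leb N) (Leb N) (\<lambda>y. \<lambda>i\<in>{..<N}. y i + (if i = 0 then c else 0)) = Leb N"
proof (rule PiM_distr_eq)
  fix i :: nat
  have "distr lborel lborel (\<lambda>x. x + (if i = 0 then c else 0)) =
        distr lborel borel (\<lambda>x. (if i = 0 then c else 0) + x)"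
    by (intro distr_cong) auto
  then show "distr lborel lborel (\<lambda>x. x + (if i = 0 then c else 0)) = (lborel :: real measure)"
    by (simp add: lborel_distr_plus)
qed (auto intro: sigma_finite_lborel)

lemma emeasure_Leb_ball_translate:
  "emeasure (Leb N) {y \<in> space (Leb N). sqdist N c y \<le> x}
     = emeasure (Leb N) {y \<in> space (Leb N). sqdist N 0 y \<le> x}"
proof -
  let ?T = "\<lambda>y. \<lambda>i\<in>{..<N}. y i + (if i = 0 then c else 0)"
  have [measurable]: "?T \<in> measurable (Leb N) (Leb N)" by measurable
  have "emeasure (Leb N) {y \<in> space (Leb N). sqdist N c y \<le> x} =
    emeasure (distr (Leb N) (Leb N) ?T) {y \<in> space (Leb N). sqdist N c y \<le> x}"
    by (simp only: Leb_translate)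
  also have "\<dots> = emeasure (Leb N) (?T -` {y \<in> space (Leb N). sqdist N c y \<le> x} \<inter> space (Leb N))"
    by (intro emeasure_distr; measurable)
  also have "?T -` {y \<in> space (Leb N). sqdist N c y \<le> x} \<inter> space (Leb N)
     = {y \<in> space (Leb N). sqdist N 0 y \<le> x}"
  proof -
    have "sqdist N c (?T y) = sqdist N 0 y" for y
      unfolding sqdist_def by (intro sum.cong) auto
    then show ?thesis by (auto simp: space_PiM)
  qed
  finally show ?thesis .
qed

lemma sqdist_nonneg: "sqdist N c y \<ge> 0"
  unfolding sqdist_def by (intro sum_nonneg) auto

lemma emeasure_Leb_ball:
  assumes "r > 0"
  shows "emeasure (Leb N) {y \<in> space (Leb N). sqrt (sqdist N 0 y) \<le> r} = ennreal (unit_ball_vol N * r ^ N)"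
proof -
  have "{y \<in> space (Leb N). sqrt (sqdist N 0 y) \<le> r} = {f. sqrt (\<Sum>i<N. (f i)\<^sup>2) \<le> r} \<inter> space (Leb N)"
    by (auto simp: sqdist_def)
  then show ?thesis using emeasure_cball_aux[of "{..<N}" r] assms by simp
qed

lemma emeasure_Leb_ball_finite: "emeasure (Leb N) {y \<in> space (Leb N). sqdist N 0 y \<le> x} < \<infinity>"
proof -
  \<comment> \<open>The enlarged radius is positive even for \<open>x \<le> 0\<close>, as the volume
    formula requires.\<close>
  have "emeasure (Leb N) {y \<in> space (Leb N). sqdist N 0 y \<le> x}
    \<le> emeasure (Leb N) {y \<in> space (Leb N). sqrt (sqdist N 0 y) \<le> sqrt \<bar>x\<bar> + 1}"
  proof (intro emeasure_mono subsetI CollectI conjI; (elim CollectE conjE)?)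
    fix y assume "sqdist N 0 y \<le> x"
    then have "sqrt (sqdist N 0 y) \<le> sqrt \<bar>x\<bar>" by (intro real_sqrt_le_mono) linarith
    then show "sqrt (sqdist N 0 y) \<le> sqrt \<bar>x\<bar> + 1" by linarith
  qed auto
  also have "\<dots> < \<infinity>"
    by (subst emeasure_Leb_ball) (auto intro: add_nonneg_pos)
  finally show ?thesis .
qed

text \<open>Closed lower half-lines are stable under intersection and generate the Borel sets. Only
  their masses have to be finite, which covers the infinite law of the norm under Lebesgue
  measure.\<close>

lemma measure_eqI_atMost:
  fixes M N :: "real measure"
  assumes sets: "sets M = sets borel" "sets N = sets borel"
    and fin: "\<And>x. emeasure M {..x} < \<infinity>"
    and eq: "\<And>x. emeasure M {..x} = emeasure N {..x}"
  shows "M = N"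
proof (rule measure_eqI_generator_eq[where E = "range (\<lambda>x::real. {..x})" and \<Omega> = UNIV and A = "\<lambda>n. {..real n}"])
  show "Int_stable (range (\<lambda>x::real. {..x}))"
    by (auto simp: Int_stable_def)
  show "sets M = sigma_sets UNIV (range (\<lambda>x::real. {..x}))"
       "sets N = sigma_sets UNIV (range (\<lambda>x::real. {..x}))"
    unfolding sets borel_eq_atMost by auto
  show "(\<Union>i. {..real i}) = UNIV"
    by (auto intro: real_arch_simple)
qed (use eq fin in \<open>auto simp: less_top\<close>)

text \<open>Integration in polar coordinates: the radial density is the derivative of the ball
  volume \<open>unit_ball_vol N * r ^ N\<close>.\<close>

lemma distr_Leb_norm:
  assumes N: "N \<ge> 1"
  shows "distr (Leb N) borel (\<lambda>y. sqrt (sqdist N 0 y)) =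
    density lborel (\<lambda>r. ennreal (unit_ball_vol N * (real N * r ^ (N - 1))) * indicator {0..} r)"
    (is "?W = ?D")
proof (rule measure_eqI_atMost)
  have W: "emeasure ?W {..r} = emeasure (Leb N) {y \<in> space (Leb N). sqrt (sqdist N 0 y) \<le> r}" for r
    by (subst emeasure_distr) (auto intro!: arg_cong[where f = "emeasure _"])
  have D: "emeasure ?D {..r} = (\<integral>\<^sup>+u. ennreal (unit_ball_vol N * (real N * u ^ (N - 1))) * indicator {0..r} u \<partial>lborel)" for r
    by (subst emeasure_density) (auto intro!: nn_integral_cong simp: indicator_def)
  have D0: "emeasure ?D {..r} = ennreal (unit_ball_vol N * r ^ N)" if "r \<ge> 0" for r
    unfolding D using that N
    by (subst nn_integral_FTC_Icc[where F = "\<lambda>r. unit_ball_vol N * r ^ N"])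
       (auto intro!: derivative_eq_intros simp: zero_power)
  have W0: "emeasure ?W {..r} = ennreal (unit_ball_vol N * r ^ N)" if "r > 0" for r
    unfolding W using emeasure_Leb_ball[OF that] .
  show eq: "emeasure ?W {..r} = emeasure ?D {..r}" for r
  proof -
    consider "r < 0" | "r = 0" | "r > 0" by linarith
    then show ?thesis
    proof cases
      case 1
      then have "{y \<in> space (Leb N). sqrt (sqdist N 0 y) \<le> r} = {}"
        using sqdist_nonneg[of N 0] by (auto simp: not_le intro: less_le_trans)
      then show ?thesis using 1 unfolding W D by (simp only: emeasure_empty) simp
    next
      \<comment> \<open>The volume formula is available for positive radii only, so the origin is
        squeezed between balls of radius tending to 0.\<close>
      case 2
      have "((\<lambda>e. ennreal (unit_ball_vol N * e ^ N)) \<longlongrightarrow> ennreal (unit_ball_vol N * 0 ^ N)) (at_right 0)"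
        by (intro tendsto_intros)
      moreover have "\<forall>\<^sub>F e in at_right 0. emeasure ?W {..0} \<le> ennreal (unit_ball_vol N * e ^ N)"
      proof -
        have "emeasure ?W {..0} \<le> ennreal (unit_ball_vol N * e ^ N)" if "e > 0" for e
          using emeasure_mono[of "{..0}" "{..e}" ?W] that W0[OF that] by auto
        then show ?thesis by (auto simp: eventually_at_right_field intro!: exI[of _ 1])
      qed
      ultimately have "emeasure ?W {..0} \<le> ennreal (unit_ball_vol N * 0 ^ N)"
        by (intro tendsto_lowerbound) auto
      then show ?thesis using 2 N D0[of 0] by (simp add: zero_power)
    next
      case 3
      then show ?thesis using W0 D0 by simp
    qed
  qed
  show "emeasure ?W {..r} < \<infinity>" for r
  proof -
    have "emeasure ?W {..r} \<le> emeasure ?W {..max r 1}" by (intro emeasure_mono) auto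
    also have "\<dots> < \<infinity>" by (subst W0) auto
    finally show ?thesis .
  qed
qed auto

lemma AE_Leb_norm_neq:
  assumes N: "N \<ge> 1"
  shows "AE y in Leb N. sqrt (sqdist N 0 y) \<noteq> r"
proof -
  have "AE x in distr (Leb N) borel (\<lambda>y. sqrt (sqdist N 0 y)). x \<noteq> r"
    unfolding distr_Leb_norm[OF N] by (subst AE_density) (auto intro!: AE_I'[of "{r}"])
  then show ?thesis
    by (subst (asm) AE_distr_iff) auto
qed

text \<open>The event that the logarithm exceeds \<open>t\<close> is, up to null sets, the ball of
  radius \<open>c * exp (-t)\<close>; the density is minus the derivative of its volume in
  \<open>t\<close>.\<close>

lemma distr_Leb_log_norm:
  assumes N: "N \<ge> 1" and c: "c > 0"
  shows "distr (Leb N) borel (\<lambda>y. ln (c / sqrt (sqdist N 0 y))) =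
    density lborel (\<lambda>u. ennreal (unit_ball_vol N * c ^ N * (real N * exp (- (real N * u)))))"
    (is "distr _ _ ?T = ?D")
proof (rule measure_eqI_lessThan)
  have D: "emeasure ?D {t<..} = ennreal (unit_ball_vol N * (c * exp (-t)) ^ N)" for t
  proof -
    have "emeasure ?D {t<..} = (\<integral>\<^sup>+u. ennreal (unit_ball_vol N * c ^ N * (real N * exp (- (real N * u)))) * indicator {t<..} u \<partial>lborel)"
      by (intro emeasure_density) auto
    also have "\<dots> = (\<integral>\<^sup>+u. ennreal (unit_ball_vol N * c ^ N * (real N * exp (- (real N * u)))) * indicator {t..} u \<partial>lborel)"
      by (intro nn_integral_cong_AE AE_I'[of "{t}"]) (auto simp: indicator_def)
    also have "\<dots> = ennreal (0 - (- (unit_ball_vol N * c ^ N * exp (- (real N * t)))))"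
    proof (rule nn_integral_FTC_atLeast)
      have "((\<lambda>u. - (unit_ball_vol N * c ^ N * exp (- (real N * u)))) \<longlongrightarrow> - (unit_ball_vol N * c ^ N * 0)) at_top"
        using N
        by (intro tendsto_intros filterlim_compose[OF exp_at_bot] filterlim_uminus_at_bot_at_top[THEN filterlim_compose]
            filterlim_tendsto_pos_mult_at_top[OF tendsto_const] filterlim_ident) auto
      then show "((\<lambda>u. - (unit_ball_vol N * c ^ N * exp (- (real N * u)))) \<longlongrightarrow> 0) at_top" by simp
    qed (use c in \<open>auto intro!: derivative_eq_intros\<close>)
    finally show ?thesis by (simp add: power_mult_distrib exp_of_nat_mult[symmetric] mult_ac)
  qed
  have W: "emeasure (distr (Leb N) borel ?T) {t<..} = ennreal (unit_ball_vol N * (c * exp (-t)) ^ N)" for t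
  proof -
    have "emeasure (distr (Leb N) borel ?T) {t<..} = emeasure (Leb N) {y \<in> space (Leb N). ?T y > t}"
      by (subst emeasure_distr) (auto intro!: arg_cong[where f = "emeasure _"])
    also have "\<dots> = emeasure (Leb N) {y \<in> space (Leb N). sqrt (sqdist N 0 y) \<le> c * exp (-t)}"
    proof (rule emeasure_eq_AE)
      \<comment> \<open>Two null sets are discarded: the origin, where the quotient takes its
        default value, and the bounding sphere, where strict and weak inequality differ.\<close>
      show "AE y in Leb N. (y \<in> {y \<in> space (Leb N). ?T y > t}) = (y \<in> {y \<in> space (Leb N). sqrt (sqdist N 0 y) \<le> c * exp (-t)})"
        using AE_Leb_norm_neq[OF N, of 0] AE_Leb_norm_neq[OF N, of "c * exp (-t)"]
      proof eventually_elim
        case (elim y)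
        define q where "q = sqrt (sqdist N 0 y)"
        have q: "q > 0" "q \<noteq> c * exp (-t)"
          using elim sqdist_nonneg[of N 0 y] by (auto simp: q_def)
        have "t < ln (c / q) \<longleftrightarrow> exp t < c / q"
          using q c ln_less_cancel_iff[of "exp t" "c / q"] by simp
        also have "\<dots> \<longleftrightarrow> q \<le> c * exp (-t)"
          using q c by (auto simp: field_simps exp_minus)
        finally show ?case by (simp add: q_def)
      qed
    qed auto
    also have "\<dots> = ennreal (unit_ball_vol N * (c * exp (-t)) ^ N)"
      using c by (intro emeasure_Leb_ball) auto
    finally show ?thesis .
  qed
  show "emeasure (distr (Leb N) borel ?T) {t<..} = emeasure ?D {t<..}" for t
    by (simp only: D W)
  show "emeasure (distr (Leb N) borel ?T) {t<..} < \<infinity>" for t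
    unfolding W by simp
qed auto

section \<open>The standard Gaussian relative to Lebesgue measure, and off-centre balls\<close>

lemma std_gauss_density:
  "gauss N 0 1 = density (Leb N) (\<lambda>y. ennreal ((1 / sqrt (2 * pi)) ^ N * exp (- sqdist N 0 y / 2)))"
proof -
  have "gauss N 0 1 = density (Leb N) (\<lambda>y. \<Prod>i<N. ennreal (std_normal_density (y i)))"
    unfolding gauss_def
    by (rule PiM_density_eq) (auto intro!: sigma_finite_lborel sigma_finite_normal)
  moreover have "(\<Prod>i<N. ennreal (std_normal_density (y i))) =
      ennreal ((1 / sqrt (2 * pi)) ^ N * exp (- sqdist N 0 y / 2))" for y
  proof -
    have "(\<Prod>i<N. std_normal_density (y i)) = (1 / sqrt (2 * pi)) ^ N * exp (\<Sum>i<N. - (y i)\<^sup>2 / 2)"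
      unfolding std_normal_density_def prod.distrib exp_sum[OF finite_lessThan] by simp
    also have "(\<Sum>i<N. - (y i)\<^sup>2 / 2) = - sqdist N 0 y / 2"
      by (simp add: sqdist_def sum_negf sum_divide_distrib)
    finally show ?thesis by (simp add: prod_ennreal)
  qed
  ultimately show ?thesis by simp
qed

text \<open>Neyman-Pearson with Lebesgue measure as null measure: a ball and its translate have the same volume, and
  the Gaussian density is radially decreasing.\<close>
lemma nc_chi2_le_central:
  assumes "lam \<ge> 0"
  shows "nc_chi2 N lam x \<le> nc_chi2 N 0 x"
proof -
  let ?K = "(1 / sqrt (2 * pi)) ^ N"
  let ?B = "\<lambda>c. {y \<in> space (Leb N). sqdist N c y \<le> x}"
  interpret prob_space "gauss N 0 1" by (rule prob_space_gauss) simp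
  \<comment> \<open>The ball is shifted by \<open>- sqrt lam\<close> instead of the Gaussian by
    \<open>sqrt lam\<close>, so both probabilities refer to the same measure.\<close>
  have "nc_chi2 N lam x = measure (gauss N 0 1) (?B (- sqrt lam))"
    using nc_chi2_eq_gauss[of 1 "- sqrt lam" 0 N x] assms by simp
  moreover have "nc_chi2 N 0 x = measure (gauss N 0 1) (?B 0)"
    using nc_chi2_eq_gauss[of 1 0 0 N x] by simp
  moreover have "emeasure (gauss N 0 1) (?B (- sqrt lam)) \<le> emeasure (gauss N 0 1) (?B 0)"
    unfolding std_gauss_density
  \<comment> \<open>The threshold is the value of the Gaussian density on the sphere of squared
    radius \<open>x\<close>.\<close>
  proof (rule neyman_pearson[where k = "ennreal (?K * exp (- x / 2))"])
    show "emeasure (Leb N) (?B (- sqrt lam)) \<le> emeasure (Leb N) (?B 0)"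
      by (simp add: emeasure_Leb_ball_translate[of N "- sqrt lam"])
    show "emeasure (Leb N) (?B (- sqrt lam)) \<noteq> \<infinity>"
      using emeasure_Leb_ball_finite[of N x] by (simp add: emeasure_Leb_ball_translate[of N "- sqrt lam"])
  qed (auto intro!: ennreal_leI mult_left_mono)
  ultimately show ?thesis by (simp add: emeasure_eq_measure)
qed

section \<open>Continuity and quantiles\<close>

text \<open>The limits at both ends make the superlevel set nonempty and bounded below, and
  continuity makes it closed, so the infimum is attained with value at least \<open>p\<close>. To
  its left the cdf is below \<open>p\<close>, and the left limit gives the other inequality.\<close>

lemma (in real_distribution) cdf_Inf_quantile:
  assumes cont: "\<And>x. isCont (cdf M) x" and p: "0 < p" "p < 1"
  shows "cdf M (Inf {x. cdf M x \<ge> p}) = p"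
proof -
  let ?S = "{x. cdf M x \<ge> p}"
  have "\<forall>\<^sub>F x in at_top. cdf M x > p"
    using cdf_lim_at_top_prob p(2) by (rule order_tendstoD)
  then have ne: "?S \<noteq> {}"
    by (auto simp: eventually_at_top_linorder intro: less_imp_le)
  have "\<forall>\<^sub>F x in at_bot. cdf M x < p"
    using cdf_lim_at_bot p(1) by (rule order_tendstoD)
  then obtain y where "cdf M y < p"
    by (auto simp: eventually_at_bot_linorder)
  then have bdd: "bdd_below ?S"
    using cdf_nondecreasing by (intro bdd_belowI[of _ y]) (metis mem_Collect_eq not_le_imp_less less_le_trans less_imp_le not_less)
  have "closed ?S"
    using cont by (intro closed_Collect_le continuous_intros continuous_at_imp_continuous_on) auto
  then have "Inf ?S \<in> ?S"
    using ne bdd by (intro closed_contains_Inf)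
  moreover have "cdf M (Inf ?S) \<le> p"
  proof (rule tendsto_upperbound)
    show "(cdf M \<longlongrightarrow> cdf M (Inf ?S)) (at_left (Inf ?S))"
      using cont[of "Inf ?S"] by (auto simp: isCont_def intro: filterlim_at_split[THEN iffD1, THEN conjunct1])
    have "cdf M x \<le> p" if "x < Inf ?S" for x
      using cInf_lower[OF _ bdd, of x] that by force
    then show "\<forall>\<^sub>F x in at_left (Inf ?S). cdf M x \<le> p"
      by (auto simp: eventually_at_filter)
  qed auto
  ultimately show ?thesis by auto
qed

lemma gauss_absolutely_continuous:
  assumes "s > 0"
  shows "absolutely_continuous (Leb N) (gauss N b s)"
proof -
  have "gauss N b s = density (Leb N) (\<lambda>y. \<Prod>i<N. ennreal (normal_density (if i = 0 then s\<^sup>2 * b else 0) s (y i)))"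
    unfolding gauss_def
    by (rule PiM_density_eq) (use assms in \<open>auto intro!: sigma_finite_lborel sigma_finite_normal\<close>)
  then show ?thesis by (simp add: absolutely_continuousI_density)
qed

lemma AE_gauss_sqdist_neq:
  assumes "N \<ge> 1" "s > 0"
  shows "AE y in gauss N b s. sqdist N 0 y \<noteq> x"
proof -
  have "AE y in Leb N. sqdist N 0 y \<noteq> x"
    using AE_Leb_norm_neq[OF assms(1), of "sqrt x"] by eventually_elim auto
  then show ?thesis
    by (rule absolutely_continuous_AE[OF sets_gauss gauss_absolutely_continuous[OF assms(2)]])
qed

text \<open>\<open>M\<close> is the law of the squared norm under
  \<open>gauss N (sqrt lam) 1\<close>. Spheres are null sets, so it has no atoms and its cdf is
  continuous.\<close>

lemma nc_chi2_cdf: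
  assumes N: "N \<ge> 1" and lam: "lam \<ge> 0"
  obtains M where "real_distribution M" "nc_chi2 N lam = cdf M" "\<And>x. isCont (cdf M) x"
proof -
  let ?G = "gauss N (sqrt lam) 1"
  define M where "M = distr ?G borel (sqdist N 0)"
  interpret G: prob_space ?G by (rule prob_space_gauss) simp
  have [measurable]: "sqdist N 0 \<in> borel_measurable ?G"
    using measurable_sqdist by (simp add: measurable_cong_sets[OF sets_gauss refl])
  interpret M: real_distribution M
    unfolding M_def by (rule G.real_distribution_distr) measurable
  have cdf: "nc_chi2 N lam = cdf M"
  proof
    fix x
    show "nc_chi2 N lam x = cdf M x"
      using nc_chi2_eq_gauss[of 1 0 "sqrt lam" N x] lam
      by (simp add: cdf_def M_def measure_distr space_gauss vimage_def Int_def conj_commute)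
  qed
  have "measure M {x} = 0" for x
  proof -
    have "AE y in ?G. sqdist N 0 y \<noteq> x"
      using N by (intro AE_gauss_sqdist_neq) auto
    then have "AE y in M. y \<noteq> x"
      unfolding M_def by (subst AE_distr_iff) auto
    then have "emeasure M {x} = 0"
      using AE_iff_measurable[of "{x}" M "\<lambda>y. y \<noteq> x"] by simp
    then show ?thesis by (simp add: measure_def)
  qed
  then show ?thesis
    using that cdf M.real_distribution_axioms M.isCont_cdf by auto
qed

lemma nc_chi2_qf:
  assumes "N \<ge> 1" "lam \<ge> 0" "0 < p" "p < 1"
  shows "nc_chi2 N lam (nc_chi2_qf N lam p) = p"
proof -
  obtain M where M: "real_distribution M" "nc_chi2 N lam = cdf M" "\<And>x. isCont (cdf M) x"
    using nc_chi2_cdf assms by blast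
  show ?thesis
    using real_distribution.cdf_Inf_quantile[OF M(1,3) assms(3,4)] unfolding M(2) nc_chi2_qf_def by simp
qed

lemma nc_chi2_mono:
  assumes "N \<ge> 1" "lam \<ge> 0" "x \<le> y"
  shows "nc_chi2 N lam x \<le> nc_chi2 N lam y"
proof -
  obtain M where M: "real_distribution M" "nc_chi2 N lam = cdf M"
    using nc_chi2_cdf assms by metis
  interpret real_distribution M by (rule M(1))
  show ?thesis unfolding M(2) using assms(3) by (rule cdf_nondecreasing)
qed

text \<open>A point below an infimum lies outside the set. This supplies the strict inequality below
  the median in \<open>chi2_separating_radius\<close>.\<close>

lemma nc_chi2_less_qf:
  assumes "N \<ge> 1" "lam \<ge> 0" "0 < p" "p < 1" "x < nc_chi2_qf N lam p"
  shows "nc_chi2 N lam x < p"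
proof (rule ccontr)
  assume "\<not> nc_chi2 N lam x < p"
  moreover obtain M where M: "real_distribution M" "nc_chi2 N lam = cdf M"
    using nc_chi2_cdf assms by metis
  interpret real_distribution M by (rule M(1))
  have "\<forall>\<^sub>F x in at_bot. cdf M x < p"
    using cdf_lim_at_bot assms(3) by (rule order_tendstoD)
  then obtain y where y: "cdf M y < p"
    by (auto simp: eventually_at_bot_linorder)
  have "y \<le> z" if "p \<le> cdf M z" for z
    using cdf_nondecreasing[of z y] y that by linarith
  then have "bdd_below {x. nc_chi2 N lam x \<ge> p}" unfolding M by (intro bdd_belowI[of _ y]) auto
  ultimately have "nc_chi2_qf N lam p \<le> x"
    unfolding nc_chi2_qf_def by (intro cInf_lower) auto
  then show False using assms(5) by simp
qed

section \<open>Bounds on the median of the central chi-squared distribution\<close>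

text \<open>Strictness on a ray suffices, since the ray contains an interval of positive
  length.\<close>

lemma nn_integral_lborel_strict_less:
  fixes f g :: "real \<Rightarrow> ennreal"
  assumes [measurable]: "f \<in> borel_measurable borel" "g \<in> borel_measurable borel"
    and fin: "(\<integral>\<^sup>+x. f x \<partial>lborel) \<noteq> \<infinity>"
    and le: "\<And>x. f x \<le> g x" and less: "\<And>x. a < x \<Longrightarrow> f x < g x"
  shows "(\<integral>\<^sup>+x. f x \<partial>lborel) < (\<integral>\<^sup>+x. g x \<partial>lborel)"
proof (rule nn_integral_less)
  show "\<not> (AE x in lborel. g x \<le> f x)"
  proof
    assume "AE x in lborel. g x \<le> f x"
    then have "AE x in lborel. x \<notin> {a<..<a+1}"
      by eventually_elim (use less in \<open>auto simp: not_le[symmetric]\<close>)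
    then have "emeasure lborel {a<..<a+1} = 0"
      by (subst (asm) AE_iff_measurable[OF _ refl]) (auto simp: greaterThanLessThan_def greaterThan_def lessThan_def Int_def)
    then show False by simp
  qed
qed (use fin le in auto)

lemma less_sinh:
  fixes x :: real
  assumes "x > 0"
  shows "x < sinh x"
proof -
  have "sinh 0 - 0 < sinh x - x"
  proof (rule DERIV_pos_imp_increasing_open[OF assms])
    fix t :: real assume "0 < t"
    then have "cosh t > 1"
      using cosh_real_strict_mono[of 0 t] by simp
    then show "\<exists>y. ((\<lambda>t. sinh t - t) has_real_derivative y) (at t) \<and> 0 < y"
      by (intro exI[of _ "cosh t - 1"]) (auto intro!: derivative_eq_intros)
  qed (auto intro!: continuous_intros)
  then show ?thesis by simp
qed

lemma nc_chi2_central: "nc_chi2 N 0 x = measure (gauss N 0 1) {y \<in> space (Leb N). sqdist N 0 y \<le> x}"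
  using nc_chi2_eq_gauss[of 1 0 0 N x] by simp

lemma one_minus_nc_chi2_central:
  "1 - nc_chi2 N 0 x = measure (gauss N 0 1) {y \<in> space (Leb N). sqdist N 0 y > x}"
proof -
  interpret prob_space "gauss N 0 1" by (rule prob_space_gauss) simp
  have "{y \<in> space (Leb N). sqdist N 0 y \<le> x} \<in> sets (gauss N 0 1)"
    unfolding sets_gauss by measurable
  from prob_compl[OF this]
  have "1 - nc_chi2 N 0 x = prob (space (Leb N) - {y \<in> space (Leb N). sqdist N 0 y \<le> x})"
    unfolding nc_chi2_central space_gauss by (rule sym)
  also have "space (Leb N) - {y \<in> space (Leb N). sqdist N 0 y \<le> x} = {y \<in> space (Leb N). sqdist N 0 y > x}"
    by auto
  finally show ?thesis .
qed

text \<open>Turns the Gaussian probability of a radial event into a one-dimensional integral: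
  \<open>\<phi>\<close> is the Lebesgue density of the radial coordinate \<open>T\<close>, and
  \<open>g\<close> is the Gaussian weight written in that coordinate.\<close>

lemma emeasure_gauss_vimage:
  assumes T [measurable]: "T \<in> borel_measurable (Leb N)"
    and distr: "distr (Leb N) borel T = density lborel \<phi>"
    and [measurable]: "\<phi> \<in> borel_measurable borel" "g \<in> borel_measurable borel" "B \<in> sets borel"
    and g: "AE y in Leb N. exp (- sqdist N 0 y / 2) = (g (T y) :: real)"
  shows "emeasure (gauss N 0 1) {y \<in> space (Leb N). T y \<in> B}
    = (\<integral>\<^sup>+u. \<phi> u * ennreal ((1 / sqrt (2 * pi)) ^ N * g u) * indicator B u \<partial>lborel)"
proof -
  let ?K = "(1 / sqrt (2 * pi)) ^ N"
  have "emeasure (gauss N 0 1) {y \<in> space (Leb N). T y \<in> B}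
    = (\<integral>\<^sup>+y. ennreal (?K * exp (- sqdist N 0 y / 2)) * indicator {y \<in> space (Leb N). T y \<in> B} y \<partial>Leb N)"
    unfolding std_gauss_density by (intro emeasure_density; measurable)
  also have "\<dots> = (\<integral>\<^sup>+y. ennreal (?K * g (T y)) * indicator B (T y) \<partial>Leb N)"
  proof (rule nn_integral_cong_AE)
    show "AE y in Leb N. ennreal (?K * exp (- sqdist N 0 y / 2)) * indicator {y \<in> space (Leb N). T y \<in> B} y
       = ennreal (?K * g (T y)) * indicator B (T y)"
      using g AE_space by eventually_elim (auto simp: indicator_def)
  qed
  also have "\<dots> = (\<integral>\<^sup>+u. ennreal (?K * g u) * indicator B u \<partial>distr (Leb N) borel T)"
    by (subst nn_integral_distr) auto
  also have "\<dots> = (\<integral>\<^sup>+u. \<phi> u * ennreal (?K * g u) * indicator B u \<partial>lborel)"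
    unfolding distr by (subst nn_integral_density) (auto simp: mult.assoc)
  finally show ?thesis .
qed

text \<open>In the coordinate \<open>u = ln (sqrt N / |y|)\<close> the density of \<open>|Z|\<close> is proportional to
  \<open>exp (- N (u + exp (- 2 u) / 2))\<close>, which is larger at \<open>u\<close> than at \<open>- u\<close> because \<open>2 u < sinh (2 u)\<close>.\<close>
lemma chi2_median_less_mean:
  assumes N: "N \<ge> 1"
  shows "nc_chi2 N 0 (real N) > 1 / 2"
proof -
  let ?G = "gauss N 0 1"
  interpret prob_space ?G by (rule prob_space_gauss) simp
  define T where "T y = ln (sqrt (real N) / sqrt (sqdist N 0 y))" for y
  define \<phi> where "\<phi> u = unit_ball_vol N * sqrt (real N) ^ N * (real N * exp (- (real N * u)))" for u
  define g where "g u = exp (- (real N * exp (-2 * u) / 2))" for u :: real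
  define \<psi> where "\<psi> u = ennreal (\<phi> u) * ennreal ((1 / sqrt (2 * pi)) ^ N * g u)" for u
  have [measurable]: "T \<in> borel_measurable (Leb N)" unfolding T_def by measurable
  have [measurable]: "\<phi> \<in> borel_measurable borel" "g \<in> borel_measurable borel"
    unfolding \<phi>_def g_def by measurable
  have [measurable]: "\<psi> \<in> borel_measurable borel" unfolding \<psi>_def by measurable
  have g: "AE y in Leb N. exp (- sqdist N 0 y / 2) = g (T y)"
    using AE_Leb_norm_neq[OF N, of 0]
  proof eventually_elim
    case (elim y)
    then have q: "sqdist N 0 y > 0" using sqdist_nonneg[of N 0 y] by auto
    have "-2 * T y = ln (sqdist N 0 y / real N)"
      using q N by (simp add: T_def ln_div ln_sqrt field_simps)
    then have "exp (-2 * T y) = sqdist N 0 y / real N" using q N by simp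
    then show ?case using N by (simp add: g_def)
  qed
  have P: "emeasure ?G {y \<in> space (Leb N). T y \<in> B} = (\<integral>\<^sup>+u. \<psi> u * indicator B u \<partial>lborel)"
    if "B \<in> sets borel" for B
    unfolding \<psi>_def using N that g
    by (intro emeasure_gauss_vimage) (simp_all add: T_def \<phi>_def distr_Leb_log_norm[of N "sqrt (real N)"])
  have sq: "AE y in ?G. sqdist N 0 y \<noteq> 0" "AE y in ?G. sqdist N 0 y \<noteq> real N"
    using N by (auto intro!: AE_gauss_sqdist_neq)
  have T_pos: "T y > 0 \<longleftrightarrow> sqdist N 0 y < real N" "T y < 0 \<longleftrightarrow> sqdist N 0 y > real N"
    if "sqdist N 0 y \<noteq> 0" for y
    using that sqdist_nonneg[of N 0 y] N
    by (auto simp: T_def ln_div ln_sqrt)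
  have "1 - nc_chi2 N 0 (real N) = measure ?G {y \<in> space (Leb N). T y \<in> {..<0}}"
    unfolding one_minus_nc_chi2_central
    by (rule measure_eq_AE) (use sq(1) T_pos in \<open>auto simp: sets_gauss elim!: eventually_mono\<close>)
  moreover have "nc_chi2 N 0 (real N) = measure ?G {y \<in> space (Leb N). T y \<in> {0<..}}"
    unfolding nc_chi2_central
  proof (rule measure_eq_AE)
    show "AE y in ?G. (y \<in> {y \<in> space (Leb N). sqdist N 0 y \<le> real N}) = (y \<in> {y \<in> space (Leb N). T y \<in> {0<..}})"
      using sq by eventually_elim (use T_pos in auto)
  qed (auto simp: sets_gauss)
  \<comment> \<open>\<open>T\<close> is positive inside the ball and negative outside. The two
    probabilities add up to 1, so it suffices to compare them, after reflecting \<open>u\<close> to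
    \<open>- u\<close>.\<close>
  moreover have "emeasure ?G {y \<in> space (Leb N). T y \<in> {..<0}} < emeasure ?G {y \<in> space (Leb N). T y \<in> {0<..}}"
  proof -
    have "emeasure ?G {y \<in> space (Leb N). T y \<in> {..<0}} = (\<integral>\<^sup>+u. \<psi> u * indicator {..<0} u \<partial>lborel)"
      by (intro P) simp
    also have refl: "\<dots> = (\<integral>\<^sup>+u. \<psi> (- u) * indicator {0<..} u \<partial>lborel)"
      by (subst nn_integral_real_affine[where c = "-1" and t = 0]) (auto simp: indicator_def intro!: nn_integral_cong)
    also have "\<dots> < (\<integral>\<^sup>+u. \<psi> u * indicator {0<..} u \<partial>lborel)"
    proof (rule nn_integral_lborel_strict_less[where a = 0])
      show "(\<integral>\<^sup>+u. \<psi> (- u) * indicator {0<..} u \<partial>lborel) \<noteq> \<infinity>"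
        unfolding refl[symmetric] by (subst P[symmetric]) auto
      have less: "\<psi> (- u) < \<psi> u" if "u > 0" for u
      proof -
        have "2 * u - exp (2 * u) / 2 < - exp (- 2 * u) / 2"
          using less_sinh[of "2 * u"] that by (simp add: sinh_def field_simps)
        then have "real N * (2 * u - exp (2 * u) / 2) < real N * (- exp (- 2 * u) / 2)"
          using N by (intro mult_strict_left_mono) auto
        then have "exp (real N * u) * g (- u) < exp (- (real N * u)) * g u"
          unfolding g_def exp_add[symmetric] exp_less_cancel_iff by (simp add: algebra_simps)
        then have "(unit_ball_vol N * sqrt (real N) ^ N * real N * (1 / sqrt (2 * pi)) ^ N) * (exp (real N * u) * g (- u))
          < (unit_ball_vol N * sqrt (real N) ^ N * real N * (1 / sqrt (2 * pi)) ^ N) * (exp (- (real N * u)) * g u)"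
          using N by (intro mult_strict_left_mono mult_pos_pos zero_less_power) auto
        then show ?thesis
          unfolding \<psi>_def \<phi>_def
          by (subst (1 2) ennreal_mult[symmetric]) (auto simp: g_def mult_ac intro!: ennreal_less_iff[THEN iffD2] mult_nonneg_nonneg)
      qed
      show "\<psi> (- u) * indicator {0<..} u \<le> \<psi> u * indicator {0<..} u" for u
        using less[of u] by (auto simp: indicator_def)
      show "\<psi> (- u) * indicator {0<..} u < \<psi> u * indicator {0<..} u" if "u > 0" for u
        using less[of u] that by (auto simp: indicator_def)
    qed measurable
    also have "\<dots> = emeasure ?G {y \<in> space (Leb N). T y \<in> {0<..}}"
      by (intro P[symmetric]) simp
    finally show ?thesis .
  qed
  ultimately show ?thesis
    by (simp add: emeasure_eq_measure ennreal_less_iff)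
qed

text \<open>After multiplication by \<open>exp (- x)\<close> the claim is that
  \<open>exp x * (x - 1) + exp (- x) * (x + 1)\<close> is nonnegative; it vanishes at 0 and has
  derivative \<open>x * (exp x - exp (- x))\<close>.\<close>

lemma one_minus_times_exp_le:
  fixes x :: real
  assumes "x \<ge> 0"
  shows "(1 - x) * exp (2 * x) \<le> 1 + x"
proof -
  have "exp 0 * (0 - 1) + exp (- 0) * (0 + 1) \<le> exp x * (x - 1) + exp (- x) * (x + 1)"
  proof (rule DERIV_nonneg_imp_nondecreasing[OF assms])
    fix t :: real assume "0 \<le> t"
    then have "0 \<le> t * (exp t - exp (- t))" by simp
    moreover have "((\<lambda>x. exp x * (x - 1) + exp (- x) * (x + 1)) has_real_derivative t * (exp t - exp (- t))) (at t)"
      by (auto intro!: derivative_eq_intros simp: algebra_simps)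
    ultimately show "\<exists>y. ((\<lambda>x. exp x * (x - 1) + exp (- x) * (x + 1)) has_real_derivative y) (at t) \<and> 0 \<le> y"
      by blast
  qed
  then have "exp x * (exp x * (1 - x)) \<le> exp x * (exp (- x) * (x + 1))"
    by (intro mult_left_mono) (auto simp: algebra_simps)
  moreover have "exp x * (exp x * (1 - x)) = (1 - x) * exp (2 * x)"
    by (simp add: exp_double power2_eq_square)
  moreover have "exp x * (exp (- x) * (x + 1)) = 1 + x"
    by (simp add: exp_minus field_simps)
  ultimately show ?thesis by (simp only:)
qed

text \<open>The mode of \<open>|Z|\<close> is \<open>m = sqrt (N - 1)\<close>, and the density at \<open>m + t\<close> is at least that at
  \<open>m - t\<close>.\<close>
lemma chi2_median_greater:
  assumes N: "N \<ge> 2"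
  shows "nc_chi2 N 0 (real N - 1) < 1 / 2"
proof -
  let ?G = "gauss N 0 1"
  interpret prob_space ?G by (rule prob_space_gauss) simp
  define m where "m = sqrt (real N - 1)"
  have m: "m > 0" "m\<^sup>2 = real N - 1" using N by (auto simp: m_def)
  define C where "C = unit_ball_vol N * real N * (1 / sqrt (2 * pi)) ^ N"
  have C: "C > 0" using N by (simp add: C_def)
  define \<rho> where "\<rho> r = ennreal (C * (r ^ (N - 1) * exp (- r\<^sup>2 / 2))) * indicator {0..} r" for r
  define \<phi> where "\<phi> r = ennreal (unit_ball_vol N * (real N * r ^ (N - 1))) * indicator {0..} r" for r
  have [measurable]: "\<rho> \<in> borel_measurable borel" "\<phi> \<in> borel_measurable borel"
    unfolding \<rho>_def \<phi>_def by measurable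
  have \<rho>: "\<rho> r = \<phi> r * ennreal ((1 / sqrt (2 * pi)) ^ N * exp (- r\<^sup>2 / 2))" for r
    unfolding \<rho>_def \<phi>_def C_def
    by (auto simp: indicator_def ennreal_mult[symmetric] mult_ac)
  have P: "emeasure ?G {y \<in> space (Leb N). sqrt (sqdist N 0 y) \<in> B} = (\<integral>\<^sup>+r. \<rho> r * indicator B r \<partial>lborel)"
    if "B \<in> sets borel" for B
    unfolding \<rho> using N that sqdist_nonneg
    by (intro emeasure_gauss_vimage) (auto simp: \<phi>_def[abs_def] distr_Leb_norm)
  have "nc_chi2 N 0 (real N - 1) = measure ?G {y \<in> space (Leb N). sqrt (sqdist N 0 y) \<in> {..<m}}"
    unfolding nc_chi2_central
  proof (rule measure_eq_AE)
    have "AE y in ?G. sqdist N 0 y \<noteq> real N - 1"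
      using N by (intro AE_gauss_sqdist_neq) auto
    then show "AE y in ?G. (y \<in> {y \<in> space (Leb N). sqdist N 0 y \<le> real N - 1}) = (y \<in> {y \<in> space (Leb N). sqrt (sqdist N 0 y) \<in> {..<m}})"
      by eventually_elim (auto simp: m_def)
  qed (auto simp: sets_gauss)
  moreover have "1 - nc_chi2 N 0 (real N - 1) = measure ?G {y \<in> space (Leb N). sqrt (sqdist N 0 y) \<in> {m<..}}"
    unfolding one_minus_nc_chi2_central by (intro arg_cong[where f = "measure _"]) (auto simp: m_def)
  moreover have "emeasure ?G {y \<in> space (Leb N). sqrt (sqdist N 0 y) \<in> {..<m}}
      < emeasure ?G {y \<in> space (Leb N). sqrt (sqdist N 0 y) \<in> {m<..}}"
  proof -
    have "emeasure ?G {y \<in> space (Leb N). sqrt (sqdist N 0 y) \<in> {..<m}} = (\<integral>\<^sup>+r. \<rho> r * indicator {..<m} r \<partial>lborel)"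
      by (intro P) simp
    also have refl: "\<dots> = (\<integral>\<^sup>+r. \<rho> (2 * m - r) * indicator {m<..} r \<partial>lborel)"
      by (subst nn_integral_real_affine[where c = "-1" and t = "2 * m"]) (auto simp: indicator_def intro!: nn_integral_cong)
    also have "\<dots> < (\<integral>\<^sup>+r. \<rho> r * indicator {m<..} r \<partial>lborel)"
    \<comment> \<open>Beyond \<open>2 * m\<close> the reflected point \<open>2 * m - r\<close> is
      negative, where \<open>\<rho>\<close> vanishes, so the inequality is strict there.\<close>
    proof (rule nn_integral_lborel_strict_less[where a = "2 * m"])
      show "(\<integral>\<^sup>+r. \<rho> (2 * m - r) * indicator {m<..} r \<partial>lborel) \<noteq> \<infinity>"
        unfolding refl[symmetric] by (subst P[symmetric]) auto
      have le: "\<rho> (2 * m - r) \<le> \<rho> r" if r: "m < r" "r \<le> 2 * m" for r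
      proof -
        \<comment> \<open>In units of \<open>m\<close> the two points are
          \<open>m * (1 + \<tau>)\<close> and \<open>m * (1 - \<tau>)\<close>. As
          \<open>m^2 = N - 1\<close>, the exponential factor is an \<open>(N - 1)\<close>-th power
          as well, and the comparison is the \<open>(N - 1)\<close>-th power of
          \<open>one_minus_times_exp_le\<close>.\<close>
        define \<tau> where "\<tau> = (r - m) / m"
        have r_eq: "r = m * (1 + \<tau>)" "2 * m - r = m * (1 - \<tau>)" and \<tau>: "0 \<le> \<tau>" "\<tau> \<le> 1"
          using r m by (auto simp: \<tau>_def field_simps)
        have "((1 - \<tau>) * exp (2 * \<tau>)) ^ (N - 1) \<le> (1 + \<tau>) ^ (N - 1)"
          using one_minus_times_exp_le[OF \<tau>(1)] \<tau> by (intro power_mono) auto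
        then have "(1 - \<tau>) ^ (N - 1) * exp (2 * m\<^sup>2 * \<tau>) \<le> (1 + \<tau>) ^ (N - 1)"
          using N by (simp add: power_mult_distrib exp_of_nat_mult[symmetric] m(2) of_nat_diff mult_ac)
        then have *: "m ^ (N - 1) * exp (- r\<^sup>2 / 2) * ((1 - \<tau>) ^ (N - 1) * exp (2 * m\<^sup>2 * \<tau>))
             \<le> m ^ (N - 1) * exp (- r\<^sup>2 / 2) * (1 + \<tau>) ^ (N - 1)"
          using m by (intro mult_left_mono) auto
        have exp_eq: "exp (- r\<^sup>2 / 2) * exp (2 * m\<^sup>2 * \<tau>) = exp (- (2 * m - r)\<^sup>2 / 2)"
          unfolding exp_add[symmetric] r_eq by (simp add: power2_eq_square field_simps)
        have "(2 * m - r) ^ (N - 1) * exp (- (2 * m - r)\<^sup>2 / 2)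
            = m ^ (N - 1) * exp (- r\<^sup>2 / 2) * ((1 - \<tau>) ^ (N - 1) * exp (2 * m\<^sup>2 * \<tau>))"
          unfolding exp_eq[symmetric] unfolding r_eq(2) power_mult_distrib by (simp only: mult_ac)
        also note *
        also have "m ^ (N - 1) * exp (- r\<^sup>2 / 2) * (1 + \<tau>) ^ (N - 1) = r ^ (N - 1) * exp (- r\<^sup>2 / 2)"
          using power_mult_distrib[of m "1 + \<tau>" "N - 1"] unfolding r_eq(1)[symmetric] by simp
        finally have "(2 * m - r) ^ (N - 1) * exp (- (2 * m - r)\<^sup>2 / 2) \<le> r ^ (N - 1) * exp (- r\<^sup>2 / 2)" .
        then show ?thesis
          unfolding \<rho>_def using C r m by (auto simp: indicator_def intro!: ennreal_leI mult_left_mono)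
      qed
      show "\<rho> (2 * m - r) * indicator {m<..} r \<le> \<rho> r * indicator {m<..} r" for r
        using le[of r] by (cases "r \<le> 2 * m") (auto simp: indicator_def \<rho>_def)
      show "\<rho> (2 * m - r) * indicator {m<..} r < \<rho> r * indicator {m<..} r" if "r > 2 * m" for r
        using that m C by (auto simp: indicator_def \<rho>_def)
    qed measurable
    also have "\<dots> = emeasure ?G {y \<in> space (Leb N). sqrt (sqdist N 0 y) \<in> {m<..}}"
      by (intro P[symmetric]) simp
    finally show ?thesis .
  qed
  ultimately show ?thesis
    by (simp add: emeasure_eq_measure ennreal_less_iff)
qed

section \<open>Chernoff bounds\<close>

lemma emeasure_density_le:
  assumes [measurable]: "A \<in> sets M" "h \<in> borel_measurable M" and le: "\<And>x. x \<in> A \<Longrightarrow> h x \<le> k"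
  shows "emeasure (density M h) A \<le> k * emeasure M A"
proof -
  have "emeasure (density M h) A = (\<integral>\<^sup>+x. h x * indicator A x \<partial>M)" by (intro emeasure_density) auto
  also have "\<dots> \<le> (\<integral>\<^sup>+x. k * indicator A x \<partial>M)"
    by (intro nn_integral_mono) (auto simp: indicator_def le)
  also have "\<dots> = k * emeasure M A" by (intro nn_integral_cmult_indicator) auto
  finally show ?thesis .
qed

text \<open>The bound is the supremum over the region of the density of \<open>gauss N b 1\<close> with respect to
  \<open>gauss N b (sqrt z)\<close>. Multiplying by \<open>1 / z - 1\<close> treats the lower (\<open>z < 1\<close>) and upper (\<open>z > 1\<close>) tails at once.\<close>
lemma gauss_chernoff:
  assumes z: "z > 0" and b: "(z - 1) * b\<^sup>2 \<le> 0"
  shows "measure (gauss N b 1) {y \<in> space (Leb N). (1 / z - 1) * sqdist N 0 y \<le> (1 / z - 1) * (real N * z)}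
    \<le> exp (real N / 2 * (ln z + 1 - z))"
proof -
  let ?A = "{y \<in> space (Leb N). (1 / z - 1) * sqdist N 0 y \<le> (1 / z - 1) * (real N * z)}"
  \<comment> \<open>Variance \<open>z\<close> is the optimal exponential tilt for
    \<open>b = 0\<close>: it moves the mean of the squared norm to the threshold
    \<open>N z\<close>.\<close>
  let ?H = "gauss N b (sqrt z)" and ?k = "exp (real N / 2 * (ln z + 1 - z))"
  let ?h = "\<lambda>y. (sqrt z / 1) ^ N * exp ((if N = 0 then 0 else ((sqrt z)\<^sup>2 - 1\<^sup>2) * b\<^sup>2 / 2)
      + (1 / (sqrt z)\<^sup>2 - 1 / 1\<^sup>2) * sqdist N 0 y / 2)"
  interpret prob_space "gauss N b 1" by (rule prob_space_gauss) simp
  interpret H: prob_space ?H by (rule prob_space_gauss) (use z in simp)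
  have [measurable]: "?A \<in> sets (Leb N)" by measurable
  have tilt: "gauss N b 1 = density ?H (\<lambda>y. ennreal (?h y))"
    using z by (intro gauss_tilt) auto
  have "ennreal (measure (gauss N b 1) ?A) = emeasure (density ?H (\<lambda>y. ennreal (?h y))) ?A"
    unfolding emeasure_eq_measure[symmetric] tilt[symmetric] ..
  also have "\<dots> \<le> ennreal ?k * emeasure ?H ?A"
  proof (rule emeasure_density_le)
    show "(\<lambda>y. ennreal (?h y)) \<in> borel_measurable ?H"
      unfolding measurable_cong_sets[OF sets_gauss refl] by measurable
    fix y assume y: "y \<in> ?A"
    have "sqrt z = exp (ln z / 2)"
      using z by (simp add: ln_sqrt[symmetric])
    then have sqrt_power: "(sqrt z / 1) ^ N = exp (real N * (ln z / 2))"
      using exp_of_nat_mult[of N "ln z / 2"] by simp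
    \<comment> \<open>For \<open>z < 1\<close> this holds for every \<open>b\<close>; for
      \<open>z > 1\<close> the hypothesis forces \<open>b = 0\<close>.\<close>
    have b_le: "(if N = 0 then 0 else ((sqrt z)\<^sup>2 - 1\<^sup>2) * b\<^sup>2 / 2) \<le> 0"
      using z b by simp
    have y_le: "(1 / (sqrt z)\<^sup>2 - 1 / 1\<^sup>2) * sqdist N 0 y / 2 \<le> real N / 2 * (1 - z)"
    proof -
      have "(1 / z - 1) * sqdist N 0 y \<le> (1 / z - 1) * (real N * z)" using y by simp
      also have "\<dots> = real N * (1 - z)" using z by (simp add: field_simps)
      finally have "(1 / z - 1) * sqdist N 0 y / 2 \<le> real N * (1 - z) / 2"
        by (rule divide_right_mono) simp
      moreover have "(sqrt z)\<^sup>2 = z" using z by simp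
      ultimately show ?thesis by (simp only: power_one div_by_1 times_divide_eq_left)
    qed
    have "?h y \<le> exp (real N * (ln z / 2)) * exp (real N / 2 * (1 - z))"
      unfolding sqrt_power
      by (intro mult_left_mono exp_le_cancel_iff[THEN iffD2]) (use b_le y_le in linarith, simp)
    also have "\<dots> = ?k" unfolding exp_add[symmetric] by (simp add: algebra_simps diff_divide_distrib)
    finally show "ennreal (?h y) \<le> ennreal ?k" by (rule ennreal_leI)
  next
    show "?A \<in> sets ?H" unfolding sets_gauss by measurable
  qed
  also have "\<dots> \<le> ennreal ?k * 1"
    by (intro mult_left_mono H.emeasure_le_1) simp
  finally show ?thesis by (simp only: mult_1_right ennreal_le_iff exp_ge_zero)
qed

text \<open>For \<open>z \<le> 1\<close> the factor \<open>1 / z - 1\<close> is nonnegative, so the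
  ball lies in the event of \<open>gauss_chernoff\<close>, whatever the noncentrality.\<close>

lemma nc_chi2_lower_tail:
  assumes "0 < z" "z \<le> 1" "lam \<ge> 0"
  shows "nc_chi2 N lam (real N * z) \<le> exp (real N / 2 * (ln z + 1 - z))"
proof -
  interpret prob_space "gauss N (sqrt lam) 1" by (rule prob_space_gauss) simp
  have "nc_chi2 N lam (real N * z) = prob {y \<in> space (Leb N). sqdist N 0 y \<le> real N * z}"
    using nc_chi2_eq_gauss[of 1 0 "sqrt lam" N] assms by simp
  also have "\<dots> \<le> prob {y \<in> space (Leb N). (1 / z - 1) * sqdist N 0 y \<le> (1 / z - 1) * (real N * z)}"
    using assms by (intro finite_measure_mono) (auto simp: sets_gauss intro!: mult_left_mono)
  also have "\<dots> \<le> exp (real N / 2 * (ln z + 1 - z))"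
    using assms by (intro gauss_chernoff) (auto simp: mult_le_0_iff)
  finally show ?thesis .
qed

text \<open>For \<open>z \<ge> 1\<close> the factor \<open>1 / z - 1\<close> is nonpositive and
  reverses the inequality, so the complement of the ball lies in the event.\<close>

lemma nc_chi2_upper_tail:
  assumes "z \<ge> 1"
  shows "1 - nc_chi2 N 0 (real N * z) \<le> exp (real N / 2 * (ln z + 1 - z))"
proof -
  interpret prob_space "gauss N 0 1" by (rule prob_space_gauss) simp
  have "1 - nc_chi2 N 0 (real N * z) = prob {y \<in> space (Leb N). sqdist N 0 y > real N * z}"
    by (rule one_minus_nc_chi2_central)
  also have "\<dots> \<le> prob {y \<in> space (Leb N). (1 / z - 1) * sqdist N 0 y \<le> (1 / z - 1) * (real N * z)}"
    using assms by (intro finite_measure_mono) (auto simp: sets_gauss intro!: mult_left_mono_neg)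
  also have "\<dots> \<le> exp (real N / 2 * (ln z + 1 - z))"
    using assms by (intro gauss_chernoff) auto
  finally show ?thesis .
qed

section \<open>Optimality of centred balls\<close>

text \<open>For \<open>s1 < s0\<close> the density ratio decreases with the norm, so centred balls
  are the Neyman-Pearson regions.\<close>

lemma gauss_ball_optimal:
  assumes s: "0 < s1" "s1 < s0" and R: "R \<in> sets (Leb N)"
    and le: "measure (gauss N b s0) R \<le> measure (gauss N b s0) {y \<in> space (Leb N). sqdist N 0 y \<le> r}"
  shows "measure (gauss N b s1) R \<le> measure (gauss N b s1) {y \<in> space (Leb N). sqdist N 0 y \<le> r}"
proof -
  let ?B = "{y \<in> space (Leb N). sqdist N 0 y \<le> r}"
  define D where "D = (if N = 0 then 0 else (s0\<^sup>2 - s1\<^sup>2) * b\<^sup>2 / 2)"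
  define \<kappa> where "\<kappa> = 1 / s0\<^sup>2 - 1 / s1\<^sup>2"
  define h where "h q = (s0 / s1) ^ N * exp (D + \<kappa> * q / 2)" for q :: real
  interpret P0: prob_space "gauss N b s0" by (rule prob_space_gauss) (use s in simp)
  interpret P1: prob_space "gauss N b s1" by (rule prob_space_gauss) (use s in simp)
  have "\<kappa> \<le> 0"
    using s by (simp add: \<kappa>_def divide_simps power_mono)
  then have h: "h q' \<le> h q" if "q \<le> q'" for q q'
    using s that unfolding h_def by (intro mult_left_mono) (auto intro: mult_left_mono_neg)
  have tilt: "gauss N b s1 = density (gauss N b s0) (\<lambda>y. ennreal (h (sqdist N 0 y)))"
    unfolding h_def D_def \<kappa>_def using s by (intro gauss_tilt) auto
  have "emeasure (gauss N b s1) R \<le> emeasure (gauss N b s1) ?B"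
    unfolding tilt
  proof (rule neyman_pearson[where k = "ennreal (h r)"])
    show "?B \<in> sets (gauss N b s0)" "R \<in> sets (gauss N b s0)"
      using R unfolding sets_gauss by measurable
    show "(\<lambda>y. ennreal (h (sqdist N 0 y))) \<in> borel_measurable (gauss N b s0)"
      unfolding h_def measurable_cong_sets[OF sets_gauss refl] by measurable
    show "emeasure (gauss N b s0) R \<le> emeasure (gauss N b s0) ?B"
      unfolding P0.emeasure_eq_measure using le by (rule ennreal_leI)
  qed (auto simp: space_gauss intro!: ennreal_leI h)
  then show ?thesis by (simp add: P1.emeasure_eq_measure)
qed

text \<open>For \<open>s0 < s1\<close> the ratio increases with the norm, so complements of centred
  balls are optimal; passing to complements again reverses the inequality.\<close>

lemma gauss_ball_optimal_compl:
  assumes s: "0 < s0" "s0 < s1" and R: "R \<in> sets (Leb N)"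
    and le: "measure (gauss N b s0) {y \<in> space (Leb N). sqdist N 0 y \<le> r} \<le> measure (gauss N b s0) R"
  shows "measure (gauss N b s1) {y \<in> space (Leb N). sqdist N 0 y \<le> r} \<le> measure (gauss N b s1) R"
proof -
  let ?B = "{y \<in> space (Leb N). sqdist N 0 y \<le> r}"
  define D where "D = (if N = 0 then 0 else (s0\<^sup>2 - s1\<^sup>2) * b\<^sup>2 / 2)"
  define \<kappa> where "\<kappa> = 1 / s0\<^sup>2 - 1 / s1\<^sup>2"
  define h where "h q = (s0 / s1) ^ N * exp (D + \<kappa> * q / 2)" for q :: real
  interpret P0: prob_space "gauss N b s0" by (rule prob_space_gauss) (use s in simp)
  interpret P1: prob_space "gauss N b s1" by (rule prob_space_gauss) (use s in simp)
  have B: "?B \<in> sets (Leb N)" by measurable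
  have "\<kappa> \<ge> 0"
    using s by (simp add: \<kappa>_def divide_simps power_mono)
  then have h: "h q \<le> h q'" if "q \<le> q'" for q q'
    using s that unfolding h_def by (intro mult_left_mono) (auto intro: mult_left_mono)
  have tilt: "gauss N b s1 = density (gauss N b s0) (\<lambda>y. ennreal (h (sqdist N 0 y)))"
    unfolding h_def D_def \<kappa>_def using s by (intro gauss_tilt) auto
  have "emeasure (gauss N b s1) (space (Leb N) - R) \<le> emeasure (gauss N b s1) (space (Leb N) - ?B)"
    unfolding tilt
  proof (rule neyman_pearson[where k = "ennreal (h r)"])
    show "space (Leb N) - ?B \<in> sets (gauss N b s0)" "space (Leb N) - R \<in> sets (gauss N b s0)"
      using R B unfolding sets_gauss by auto
    show "(\<lambda>y. ennreal (h (sqdist N 0 y))) \<in> borel_measurable (gauss N b s0)"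
      unfolding h_def measurable_cong_sets[OF sets_gauss refl] by measurable
    show "emeasure (gauss N b s0) (space (Leb N) - R) \<le> emeasure (gauss N b s0) (space (Leb N) - ?B)"
      unfolding P0.emeasure_eq_measure
      using le R B P0.prob_compl[of R] P0.prob_compl[of ?B]
      by (intro ennreal_leI) (simp add: space_gauss sets_gauss)
  qed (auto simp: space_gauss intro!: ennreal_leI h)
  then show ?thesis
    using R B P1.prob_compl[of R] P1.prob_compl[of ?B]
    by (simp add: P1.emeasure_eq_measure space_gauss sets_gauss)
qed

section \<open>The two lower bounds on the optimal adversarial probability\<close>

lemma sets_sqdist_ball: "{y \<in> space (Leb N). sqdist N c y \<le> r} \<in> sets (Leb N)"
  by measurable

lemma xi_gt_greater_half:
  assumes N: "N \<ge> 1" and p: "0 < pA" "pA < 1" and s: "0 < s1" "s1 < s0" and a: "a \<ge> 0"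
    and cond: "ln (s1\<^sup>2 / s0\<^sup>2) + 1 - s1\<^sup>2 / s0\<^sup>2 < 2 * ln (1 - pA) / real N"
  shows "xi_gt N s0 pA a s1 > 1 / 2"
proof -
  \<comment> \<open>With this \<open>b\<close> the means \<open>s0^2 b\<close> and
    \<open>s1^2 b\<close> are at distance \<open>a\<close>, and the origin is the centre of the
    likelihood-ratio ball.\<close>
  define b where "b = a / (s0\<^sup>2 - s1\<^sup>2)"
  define z where "z = s1\<^sup>2 / s0\<^sup>2"
  define q where "q = nc_chi2_qf N ((s0 * b)\<^sup>2) (1 - pA)"
  have s2: "s1\<^sup>2 < s0\<^sup>2" using s by (simp add: power_strict_mono)
  then have b: "b \<ge> 0" and z: "0 < z" "z \<le> 1"
    using a s by (auto simp: b_def z_def)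
  let ?P0 = "measure (gauss N b s0)" and ?P1 = "measure (gauss N b s1)"
  let ?B = "{y \<in> space (Leb N). sqdist N 0 y \<le> s0\<^sup>2 * q}"
  let ?R = "{y \<in> space (Leb N). sqdist N (s1\<^sup>2 * b) y \<le> s1\<^sup>2 * real N}"
  have "xi_gt N s0 pA a s1 = nc_chi2 N ((s1 * b)\<^sup>2) (s0\<^sup>2 / s1\<^sup>2 * q)"
    unfolding xi_gt_def q_def b_def by (simp add: power_mult_distrib power_divide)
  also have "\<dots> = ?P1 ?B"
    using nc_chi2_eq_gauss[of s1 0 b N "s0\<^sup>2 / s1\<^sup>2 * q"] s b by simp
  finally have xi: "xi_gt N s0 pA a s1 = ?P1 ?B" .
  have "s1\<^sup>2 * b \<le> s0\<^sup>2 * b" using s2 b by (intro mult_right_mono) auto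
  then have "?P0 ?R = nc_chi2 N ((s0 * b - s1\<^sup>2 * b / s0)\<^sup>2) (real N * z)"
    using nc_chi2_eq_gauss[of s0 "s1\<^sup>2 * b" b N "real N * z"] s
    by (simp add: z_def mult.commute)
  also have "\<dots> \<le> exp (real N / 2 * (ln z + 1 - z))"
    using z by (intro nc_chi2_lower_tail) auto
  \<comment> \<open>The hypothesis multiplied by \<open>N / 2\<close> says precisely that the
    Chernoff exponent is below \<open>ln (1 - pA)\<close>.\<close>
  also have "\<dots> \<le> exp (ln (1 - pA))"
    using cond N by (simp add: z_def field_simps)
  also have "\<dots> = 1 - pA" using p by simp
  also have "\<dots> = nc_chi2 N ((s0 * b)\<^sup>2) q"
    unfolding q_def using N p by (intro nc_chi2_qf[symmetric]) auto
  also have "\<dots> = ?P0 ?B"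
    using nc_chi2_eq_gauss[of s0 0 b N q] s b by simp
  finally have "?P1 ?R \<le> ?P1 ?B"
    by (intro gauss_ball_optimal[OF s sets_sqdist_ball])
  moreover have "?P1 ?R = nc_chi2 N 0 (real N)"
    using nc_chi2_eq_gauss[of s1 "s1\<^sup>2 * b" b N "real N"] s by (simp add: power2_eq_square)
  ultimately show ?thesis
    unfolding xi using chi2_median_less_mean[OF N] by linarith
qed

text \<open>With \<open>c\<close> the variance ratio, \<open>x\<close> is a squared radius in units
  of the smaller variance and \<open>x / c\<close> in units of the larger. The main choice is
  \<open>x = c * (N - 1)\<close>: then \<open>x / c = N - 1\<close> is below the median, and the
  upper Chernoff bound is the hypothesis.\<close>

lemma chi2_separating_radius:
  assumes N: "N \<ge> 2" and p: "0 < p" "p < 1" and c: "c > 1"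
    and cond: "ln (c * ((real N - 1) / real N)) + 1 - c * ((real N - 1) / real N) < 2 * ln (1 - p) / real N"
  obtains x where "nc_chi2 N 0 (x / c) < 1 / 2" "p \<le> nc_chi2 N 0 x"
proof -
  define z where "z = c * ((real N - 1) / real N)"
  have "ln z + 1 - z < 2 * ln (1 - p) / real N" using cond by (simp add: z_def)
  then have cond': "real N / 2 * (ln z + 1 - z) < ln (1 - p)"
    using N by (simp add: field_simps)
  have Nz: "real N * z / c = real N - 1" using N c by (simp add: z_def)
  have N1: "(real N - 1) / real N = 1 - 1 / real N" using N by (simp add: field_simps)
  show ?thesis
  proof (cases "z \<ge> 1")
    case True
    have "1 - nc_chi2 N 0 (real N * z) \<le> exp (real N / 2 * (ln z + 1 - z))"
      using True by (rule nc_chi2_upper_tail)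
    also have "\<dots> \<le> exp (ln (1 - p))" using cond' by simp
    also have "\<dots> = 1 - p" using p by simp
    finally have "p \<le> nc_chi2 N 0 (real N * z)" by simp
    moreover have "nc_chi2 N 0 (real N * z / c) < 1 / 2"
      unfolding Nz using N by (rule chi2_median_greater)
    ultimately show ?thesis using that by blast
  next
    case False
    \<comment> \<open>Here the hypothesis forces \<open>p \<le> 1/2\<close>, and the median itself is a suitable radius.\<close>
    define y where "y = 1 / real N"
    have y: "0 < y" "y \<le> 1 / 2" using N by (auto simp: y_def field_simps)
    have zy: "1 - y \<le> z"
      using c y mult_right_mono[of 1 c "1 - y"] unfolding z_def N1 y_def[symmetric] by simp
    have z0: "z > 0" using zy y by linarith
    \<comment> \<open>On \<open>(0, 1]\<close> the function \<open>ln z - z\<close> increases, so on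
      \<open>1 - y \<le> z < 1\<close> it is bounded below by its value at
      \<open>1 - y\<close>.\<close>
    have "ln (1 - y) - ln z \<le> (1 - y) / z - 1"
      using ln_le_minus_one[of "(1 - y) / z"] z0 y by (simp add: ln_div)
    also have "\<dots> = ((1 - y) - z) * (1 / z)" using z0 by (simp add: field_simps)
    also have "\<dots> \<le> ((1 - y) - z) * 1"
      using False z0 zy by (intro mult_left_mono_neg) auto
    finally have "ln (1 - y) + y \<le> ln z + 1 - z" by simp
    moreover have "- y - 2 * y\<^sup>2 \<le> ln (1 - y)"
      using ln_one_minus_pos_lower_bound[of y] y by simp
    ultimately have "- 2 * y\<^sup>2 \<le> ln z + 1 - z" by simp
    then have "real N / 2 * (- 2 * y\<^sup>2) \<le> real N / 2 * (ln z + 1 - z)"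
      by (intro mult_left_mono) auto
    also have "real N / 2 * (- 2 * y\<^sup>2) = - y" using N by (simp add: y_def power2_eq_square)
    finally have "- (1 / 2) < ln (1 - p)" using cond' y by linarith
    also have "ln (1 - p) \<le> - p" using p ln_le_minus_one[of "1 - p"] by simp
    finally have p2: "p \<le> 1 / 2" by simp
    define m where "m = nc_chi2_qf N 0 (1 / 2)"
    have m: "nc_chi2 N 0 m = 1 / 2"
      unfolding m_def using N by (intro nc_chi2_qf) auto
    \<comment> \<open>This makes the median positive, so dividing by \<open>c > 1\<close> strictly
      decreases it.\<close>
    have "real N - 1 < m"
      using nc_chi2_mono[of N 0 m "real N - 1"] chi2_median_greater[OF N] N m by force
    then have "m / c < m" using c N by (simp add: field_simps)
    then have "nc_chi2 N 0 (m / c) < 1 / 2"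
      unfolding m_def using N by (intro nc_chi2_less_qf) auto
    then show ?thesis using that[of m] m p2 by simp
  qed
qed

lemma xi_lt_greater_half:
  assumes N: "N \<ge> 2" and p: "0 < pA" "pA < 1" and s: "0 < s0" "s0 < s1" and a: "a \<ge> 0"
    and cond: "ln (s1\<^sup>2 / s0\<^sup>2 * ((real N - 1) / real N)) + 1
            - s1\<^sup>2 / s0\<^sup>2 * ((real N - 1) / real N) < 2 * ln (1 - pA) / real N"
  shows "xi_lt N s0 pA a s1 > 1 / 2"
proof -
  define b where "b = a / (s1\<^sup>2 - s0\<^sup>2)"
  define q where "q = nc_chi2_qf N ((s0 * b)\<^sup>2) pA"
  have s2: "s0\<^sup>2 < s1\<^sup>2" using s by (simp add: power_strict_mono)
  then have b: "b \<ge> 0" and c: "s1\<^sup>2 / s0\<^sup>2 > 1"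
    using a s by (auto simp: b_def)
  obtain x where x: "nc_chi2 N 0 (x / (s1\<^sup>2 / s0\<^sup>2)) < 1 / 2" "pA \<le> nc_chi2 N 0 x"
    using chi2_separating_radius[OF N p c cond] .
  let ?P0 = "measure (gauss N b s0)" and ?P1 = "measure (gauss N b s1)"
  let ?B = "{y \<in> space (Leb N). sqdist N 0 y \<le> s0\<^sup>2 * q}"
  let ?R = "{y \<in> space (Leb N). sqdist N (s0\<^sup>2 * b) y \<le> s0\<^sup>2 * x}"
  have "xi_lt N s0 pA a s1 = 1 - nc_chi2 N ((s1 * b)\<^sup>2) (s0\<^sup>2 / s1\<^sup>2 * q)"
    unfolding xi_lt_def q_def b_def by (simp add: power_mult_distrib power_divide)
  also have "\<dots> = 1 - ?P1 ?B"
    using nc_chi2_eq_gauss[of s1 0 b N "s0\<^sup>2 / s1\<^sup>2 * q"] s b by simp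
  finally have xi: "xi_lt N s0 pA a s1 = 1 - ?P1 ?B" .
  have "?P0 ?B = nc_chi2 N ((s0 * b)\<^sup>2) q"
    using nc_chi2_eq_gauss[of s0 0 b N q] s b by simp
  also have "\<dots> = pA"
    unfolding q_def using N p by (intro nc_chi2_qf) auto
  also have "\<dots> \<le> nc_chi2 N 0 x" by (rule x)
  also have "\<dots> = ?P0 ?R"
    using nc_chi2_eq_gauss[of s0 "s0\<^sup>2 * b" b N x] s by (simp add: power2_eq_square)
  finally have BR: "?P1 ?B \<le> ?P1 ?R"
    by (intro gauss_ball_optimal_compl[OF s sets_sqdist_ball])
  have "s0\<^sup>2 * b \<le> s1\<^sup>2 * b" using s2 b by (intro mult_right_mono) auto
  then have "?P1 ?R = nc_chi2 N ((s1 * b - s0\<^sup>2 * b / s1)\<^sup>2) (x / (s1\<^sup>2 / s0\<^sup>2))"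
    using nc_chi2_eq_gauss[of s1 "s0\<^sup>2 * b" b N "x / (s1\<^sup>2 / s0\<^sup>2)"] s
    by (simp add: mult.commute)
  \<comment> \<open>Under the larger variance the ball around \<open>s0^2 b\<close> is off centre;
    centring it only increases its measure.\<close>
  also have "\<dots> \<le> nc_chi2 N 0 (x / (s1\<^sup>2 / s0\<^sup>2))"
    by (rule nc_chi2_le_central) simp
  finally show ?thesis using x(1) BR unfolding xi by linarith
qed

theorem mainTheorem4:
  fixes N :: nat and pA sigma0 sigma1 :: real
  assumes "N \<ge> 2" and "0 < pA" and "pA < 1" and "0 < sigma0" and "0 < sigma1"
  shows "(sigma0 > sigma1 \<and>
          ln (sigma1\<^sup>2 / sigma0\<^sup>2) + 1 - sigma1\<^sup>2 / sigma0\<^sup>2 < 2 * ln (1 - pA) / real N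
          \<longrightarrow> (\<forall>a::real. a \<ge> 0 \<longrightarrow> xi_gt N sigma0 pA a sigma1 > 1/2))
       \<and> (sigma0 < sigma1 \<and>
          ln (sigma1\<^sup>2 / sigma0\<^sup>2 * ((real N - 1) / real N)) + 1
            - sigma1\<^sup>2 / sigma0\<^sup>2 * ((real N - 1) / real N) < 2 * ln (1 - pA) / real N
          \<longrightarrow> (\<forall>a::real. a \<ge> 0 \<longrightarrow> xi_lt N sigma0 pA a sigma1 > 1/2))"
  using assms xi_gt_greater_half[of N pA sigma1 sigma0] xi_lt_greater_half[of N pA sigma0 sigma1]
  by auto

end
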